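(* Let $G$ be a finite non-abelian group, let $n \geq 2$ be an integer, and let $\sigma \in S_n$ be a permutation of $\{1,\dots,n\}$. Let $k$ be the fewest number of block transpositions in a factorization of $\sigma$ as a product of block transpositions in $S_n$. Then $$\frac{\#\{(a_1,\dots,a_n)\in G^n : a_1 a_2\cdots a_n = a_{\sigma(1)} a_{\sigma(2)}\cdots a_{\sigma(n)}\}}{|G|^n} \leq \frac{1}{2} + \frac{1}{2^{2k+1}}.$$
   Context: $S_n$ denotes the symmetric group on $\{1,\dots,n\}$. A block transposition is a permutation that transposes two disjoint blocks of consecutive elements, the two blocks not being required to be adjacent. Explicitly, $\tau\in S_n$ is a block transposition if there are integers $1\le p\le q<r\le s\le n$ such that the sequence $(\tau(1),\dots,\tau(n))$ is obtained from $(1,2,\dots,n)$ by interchanging the block $p,p+1,\dots,q$ with the block $r,r+1,\dots,s$, i.e. it equals $$(1,\dots,p-1,\; r,\dots,s,\; q+1,\dots,r-1,\; p,\dots,q,\; s+1,\dots,n).$$ For example, interchanging the blocks $[1,2,3]$ and $[4,5]$ turns $a_1a_2a_3a_4a_5$ into $(a_4a_5)(a_1a_2a_3)$. The identity permutation is the empty product, with $k=0$. *)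

theory Defs
  imports Complex_Main "HOL-Library.FuncSet" "HOL-Algebra.Sym_Groups"
begin

definition list_prod :: "('a, 'b) monoid_scheme \<Rightarrow> 'a list \<Rightarrow> 'a" where
  "list_prod G xs = foldr (\<otimes>\<^bsub>G\<^esub>) xs \<one>\<^bsub>G\<^esub>"

text \<open>The blocks \<open>p..q\<close> and \<open>r..s\<close> are nonempty and disjoint, but need not be adjacent.
  The list \<open>[i..<Suc j]\<close> enumerates \<open>i, \<dots>, j\<close>.\<close>

definition block_transposition :: "nat \<Rightarrow> (nat \<Rightarrow> nat) \<Rightarrow> bool" where
  "block_transposition n \<tau> \<longleftrightarrow> \<tau> \<in> carrier (sym_group n) \<and>
     (\<exists>p q r s. 1 \<le> p \<and> p \<le> q \<and> q < r \<and> r \<le> s \<and> s \<le> n \<and>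
        map \<tau> [1..<Suc n] =
          [1..<p] @ [r..<Suc s] @ [Suc q..<r] @ [p..<Suc q] @ [Suc s..<Suc n])"

definition block_factorization :: "nat \<Rightarrow> (nat \<Rightarrow> nat) list \<Rightarrow> (nat \<Rightarrow> nat) \<Rightarrow> bool" where
  "block_factorization n ts \<sigma> \<longleftrightarrow>
     (\<forall>\<tau>\<in>set ts. block_transposition n \<tau>) \<and> list_prod (sym_group n) ts = \<sigma>"

text \<open>The minimum exists for every \<open>\<sigma>\<close> in the symmetric group, by
  \<open>block_factorization_exists\<close> below.\<close>

definition block_transposition_length :: "nat \<Rightarrow> (nat \<Rightarrow> nat) \<Rightarrow> nat" where
  "block_transposition_length n \<sigma> = (LEAST k. \<exists>ts. length ts = k \<and> block_factorization n ts \<sigma>)"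

lemma block_transposition_transpose:
  assumes "1 \<le> i" "i < j" "j \<le> n"
  shows "block_transposition n (transpose i j)"
proof -
  have *: "[1..<Suc n] = [1..<i] @ [i..<Suc i] @ [Suc i..<j] @ [j..<Suc j] @ [Suc j..<Suc n]"
  proof -
    have u: "[a..<c] = [a..<b] @ [b..<c]" if "a \<le> b" "b \<le> c" for a b c :: nat
      using that upt_add_eq_append[of a b "c - b"] by simp
    show ?thesis
      using assms u[of 1 i "Suc n"] u[of i "Suc i" "Suc n"] u[of "Suc i" j "Suc n"]
        u[of j "Suc j" "Suc n"] by (simp del: upt_Suc)
  qed
  have "map (transpose i j) [1..<Suc n] =
      [1..<i] @ [j..<Suc j] @ [Suc i..<j] @ [i..<Suc i] @ [Suc j..<Suc n]"
    unfolding * map_append using assms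
    by (intro arg_cong2[where f = "(@)"] map_idI) (auto simp: transpose_def upt_conv_Cons simp del: upt_Suc)
  moreover have "transpose i j \<in> carrier (sym_group n)"
    using assms by (auto simp: sym_group_def intro!: permutes_swap_id)
  ultimately show ?thesis
    using assms unfolding block_transposition_def by (meson less_imp_le_nat order_refl)
qed

lemma block_factorization_exists:
  assumes "\<sigma> \<in> carrier (sym_group n)"
  shows "\<exists>ts. block_factorization n ts \<sigma>"
proof -
  have "\<sigma> permutes {1..n}" "finite {1..n}"
    using assms by (auto simp: sym_group_def)
  then show ?thesis
  proof (induction rule: permutes_induct)
    case id
    have "block_factorization n [] id"
      by (simp add: block_factorization_def list_prod_def sym_group_def)
    then show ?case ..
  next
    case (swap a b p)
    then obtain ts where ts: "block_factorization n ts p" by blast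
    have "block_transposition n (transpose a b)"
      using swap block_transposition_transpose[of a b n] block_transposition_transpose[of b a n]
      by (cases "a < b") (auto simp: transpose_commute)
    then have "block_factorization n (transpose a b # ts) (transpose a b \<circ> p)"
      using ts by (auto simp: block_factorization_def list_prod_def sym_group_def)
    then show ?case ..
  qed
qed

end

theory Submission
  imports Defs
begin

text \<open>
  Write \<open>c(g)\<close> for the proportion of pairs \<open>(u, w)\<close> with commutator \<open>u w u\<^sup>-\<^sup>1 w\<^sup>-\<^sup>1 = g\<close>, and
  \<open>c\<close> for \<open>c(1)\<close>, the commuting probability of \<open>G\<close>. Three facts about it are needed: \<open>c(g) \<le> c\<close>
  for every \<open>g\<close>, trivially \<open>c(g) \<le> 1 - c\<close> for \<open>g \<noteq> 1\<close>, and \<open>c \<le> 5/8\<close> because \<open>G\<close> is not abelian.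

  Suppose \<open>\<sigma>\<close> is not the identity, let \<open>x\<close> be the least point moved by \<open>\<sigma>\<close>, and let \<open>y\<close> be the largest
  letter to the left of \<open>x\<close> in the sequence of values of \<open>\<sigma>\<close>. With a
  fixed letter \<open>n + 1\<close> appended, that sequence has the form \<open>P A y V x B (y+1) T\<close> with
  \<open>P = 1, \<dots>, x-1\<close>, and interchanging the blocks \<open>A y\<close> and \<open>x B\<close> gives
  \<open>P x B V A y (y+1) T\<close>, the sequence of a permutation \<open>\<sigma>'\<close> with at least one more leading fixed point
  (lemma \<open>block_transposition_fixing_next\<close>). Both \<open>x-1, x\<close> and \<open>y, y+1\<close> have become adjacent, and
  this is why the move is an optimal one: it lowers the genus of the equation by one. In group terms, fix
  the values of all letters other than \<open>x, y, y+1\<close> and also the product \<open>d\<close> of the values of \<open>y\<close> and \<open>y+1\<close>. After a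
  change of variables the equation for \<open>\<sigma>\<close> in the two remaining unknowns reads \<open>[u, w] = \<gamma>\<close>, where \<open>\<gamma>\<close>
  depends only on what has been fixed, and the equation for \<open>\<sigma>'\<close> reads \<open>\<gamma> = 1\<close>.

  Hence the solution probabilities \<open>p\<close> of \<open>\<sigma>\<close> and \<open>p'\<close> of \<open>\<sigma>'\<close> satisfy
  \<open>p \<le> p' c + (1 - p') min c (1 - c)\<close>. If \<open>c \<le> 1/2\<close>, this is at most \<open>1/2\<close>; otherwise it equals
  \<open>1/2 + 2 (p' - 1/2) (c - 1/2)\<close>, where \<open>2 (c - 1/2) \<le> 1/4\<close>. So a bound \<open>p' \<le> 1/2 + e\<close> with \<open>e \<ge> 0\<close> gives
  \<open>p \<le> 1/2 + e/4\<close>, and each block transposition on the way from \<open>\<sigma>\<close> to the identity gains a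
  factor \<open>1/4\<close> (lemma \<open>word_eq_prob_undo_move\<close>). The number of moves made is at least the minimal number
  \<open>k\<close>, and the bound decreases with it.
\<close>

section \<open>Products of lists and proper subgroups\<close>

lemma list_prod_Nil [simp]: "list_prod G [] = \<one>\<^bsub>G\<^esub>"
  by (simp add: list_prod_def)

lemma list_prod_Cons [simp]: "list_prod G (x # xs) = x \<otimes>\<^bsub>G\<^esub> list_prod G xs"
  by (simp add: list_prod_def)

lemma (in monoid) list_prod_closed [simp]:
  "set xs \<subseteq> carrier G \<Longrightarrow> list_prod G xs \<in> carrier G"
  by (induction xs) auto

lemma (in monoid) list_prod_append:
  "set xs \<subseteq> carrier G \<Longrightarrow> set ys \<subseteq> carrier G \<Longrightarrow>
    list_prod G (xs @ ys) = list_prod G xs \<otimes> list_prod G ys"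
  by (induction xs) (auto simp: m_assoc)

lemma (in group) twice_card_proper_subgroup_le:
  assumes "finite (carrier G)" "subgroup H G" "subgroup K G" "H \<subset> K"
  shows "2 * card H \<le> card K"
proof -
  interpret H: subgroup H G by fact
  interpret K: subgroup K G by fact
  obtain k where k: "k \<in> K" "k \<notin> H" using assms by blast
  have fin: "finite K" using assms(1) K.subset finite_subset by blast
  then have finH: "finite H" using assms(4) finite_subset by blast
  have inj: "inj_on ((\<otimes>) k) H"
    using k by (auto intro!: inj_onI)
  have "H \<inter> (\<otimes>) k ` H = {}"
  proof -
    have False if "h \<in> H" "k \<otimes> h \<in> H" for h
    proof -
      have "k \<otimes> h \<otimes> inv h \<in> H" using that by blast
      then show False using that k by (simp add: m_assoc)
    qed
    then show ?thesis by blast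
  qed
  then have "card (H \<union> (\<otimes>) k ` H) = 2 * card H"
    using finH card_image[OF inj] by (simp add: card_Un_disjoint)
  moreover have "H \<union> (\<otimes>) k ` H \<subseteq> K" using assms(4) k by blast
  ultimately show ?thesis using card_mono[OF fin] by metis
qed

section \<open>The distribution of the commutator\<close>

definition centralizer_of :: "('a, 'b) monoid_scheme \<Rightarrow> 'a \<Rightarrow> 'a set" where
  "centralizer_of G u = {w \<in> carrier G. u \<otimes>\<^bsub>G\<^esub> w = w \<otimes>\<^bsub>G\<^esub> u}"

lemma (in group) subgroup_centralizer_of:
  assumes u: "u \<in> carrier G"
  shows "subgroup (centralizer_of G u) G"
proof (rule subgroupI)
  fix a assume "a \<in> centralizer_of G u"
  then have a: "a \<in> carrier G" "u \<otimes> a = a \<otimes> u" by (auto simp: centralizer_of_def)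
  then show "inv a \<in> centralizer_of G u"
    using u by (simp add: centralizer_of_def) (metis inv_closed inv_solve_left inv_solve_right m_assoc m_closed)
  fix b assume "b \<in> centralizer_of G u"
  then have b: "b \<in> carrier G" "u \<otimes> b = b \<otimes> u" by (auto simp: centralizer_of_def)
  show "a \<otimes> b \<in> centralizer_of G u"
    using a b u by (simp add: centralizer_of_def) (metis m_assoc)
qed (use u in \<open>auto simp: centralizer_of_def\<close>)

text \<open>The equation \<open>[u, w] = g\<close> is written without inverses, so that for \<open>g = \<one>\<close> it is literally
  commutation of \<open>u\<close> and \<open>w\<close>.\<close>

definition commutator_fibre :: "('a, 'b) monoid_scheme \<Rightarrow> 'a \<Rightarrow> ('a \<times> 'a) set" where
  "commutator_fibre G g =
     {(u, w) \<in> carrier G \<times> carrier G. u \<otimes>\<^bsub>G\<^esub> w = g \<otimes>\<^bsub>G\<^esub> w \<otimes>\<^bsub>G\<^esub> u}"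

lemma commutator_fibre_Sigma:
  "commutator_fibre G g =
     (SIGMA u:carrier G. {w \<in> carrier G. u \<otimes>\<^bsub>G\<^esub> w = g \<otimes>\<^bsub>G\<^esub> w \<otimes>\<^bsub>G\<^esub> u})"
  by (auto simp: commutator_fibre_def)

lemma (in group) card_commutator_fibre_one:
  "finite (carrier G) \<Longrightarrow>
    card (commutator_fibre G \<one>) = (\<Sum>u\<in>carrier G. card (centralizer_of G u))"
  unfolding commutator_fibre_Sigma centralizer_of_def
  by (subst card_SigmaI) (auto intro!: sum.cong arg_cong[where f = card])

text \<open>For fixed \<open>u\<close>, the solutions \<open>w\<close> of \<open>[u, w] = g\<close> form either the empty set or a left coset of the
  centralizer of \<open>u\<close>.\<close>

lemma (in group) card_commutator_fibre_le_one:
  assumes fin: "finite (carrier G)" and g: "g \<in> carrier G"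
  shows "card (commutator_fibre G g) \<le> card (commutator_fibre G \<one>)"
proof -
  have "card {w \<in> carrier G. u \<otimes> w = g \<otimes> w \<otimes> u} \<le> card (centralizer_of G u)" (is "card ?W \<le> _")
    if u: "u \<in> carrier G" for u
  proof (cases "?W = {}")
    case False
    then obtain v where v: "v \<in> carrier G" "u \<otimes> v = g \<otimes> v \<otimes> u" by blast
    have "inv v \<otimes> w \<in> centralizer_of G u" if w: "w \<in> ?W" for w
    proof -
      have "v \<otimes> (u \<otimes> (inv v \<otimes> w)) = inv g \<otimes> (g \<otimes> v \<otimes> u) \<otimes> (inv v \<otimes> w)"
        using u v(1) g w by (simp add: m_assoc[symmetric])
      also have "\<dots> = inv g \<otimes> (u \<otimes> v) \<otimes> (inv v \<otimes> w)" using v by simp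
      also have "\<dots> = inv g \<otimes> (u \<otimes> (v \<otimes> inv v) \<otimes> w)"
        using u v(1) g w by (simp only: m_assoc m_closed inv_closed mem_Collect_eq)
      also have "\<dots> = inv g \<otimes> (g \<otimes> w \<otimes> u)" using u v(1) g w by auto
      also have "\<dots> = v \<otimes> (inv v \<otimes> w \<otimes> u)"
        using u v(1) g w by (simp add: m_assoc[symmetric])
      finally show ?thesis
        using u v(1) w by (simp add: centralizer_of_def)
    qed
    moreover have "inj_on (\<lambda>w. inv v \<otimes> w) ?W"
      using v by (auto intro!: inj_onI)
    moreover have "finite (centralizer_of G u)" using fin by (simp add: centralizer_of_def)
    ultimately show ?thesis by (intro card_inj_on_le[of "\<lambda>w. inv v \<otimes> w"]) auto
  qed (metis card.empty zero_le)
  then show ?thesis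
    unfolding card_commutator_fibre_one[OF fin] unfolding commutator_fibre_Sigma
    using fin by (subst card_SigmaI) (auto intro!: sum_mono)
qed

lemma (in group) card_commutator_fibre_add_le:
  assumes fin: "finite (carrier G)" and g: "g \<in> carrier G" "g \<noteq> \<one>"
  shows "card (commutator_fibre G g) + card (commutator_fibre G \<one>) \<le> card (carrier G) ^ 2"
proof -
  have "g = \<one>" if "u \<in> carrier G" "w \<in> carrier G"
    "u \<otimes> w = g \<otimes> w \<otimes> u" "u \<otimes> w = \<one> \<otimes> w \<otimes> u" for u w
  proof -
    have "g \<otimes> (w \<otimes> u) = w \<otimes> u" using that g by (simp add: m_assoc)
    then show ?thesis using that g by simp
  qed
  then have "commutator_fibre G g \<inter> commutator_fibre G \<one> = {}"
    using g by (fastforce simp: commutator_fibre_def)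
  moreover have sub: "commutator_fibre G h \<subseteq> carrier G \<times> carrier G" for h
    by (auto simp: commutator_fibre_def)
  moreover have finp: "finite (carrier G \<times> carrier G)" using fin by simp
  ultimately have "card (commutator_fibre G g) + card (commutator_fibre G \<one>) \<le> card (carrier G \<times> carrier G)"
    by (metis card_Un_disjoint card_mono finite_subset le_sup_iff)
  then show ?thesis by (simp add: card_cartesian_product power2_eq_square)
qed

text \<open>The centre is properly contained in a proper centralizer, so its index is at least four, and each
  noncentral element commutes with at most half of the group:
  \<open>1/4 + 3/4 \<cdot> 1/2 = 5/8\<close>.\<close>

lemma (in group) commuting_pairs_le_five_eighths:
  assumes fin: "finite (carrier G)" and nonab: "\<not> comm_group G"
  shows "8 * card (commutator_fibre G \<one>) \<le> 5 * card (carrier G) ^ 2"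
proof -
  define Z where "Z = {u \<in> carrier G. centralizer_of G u = carrier G}"
  let ?n = "card (carrier G)"
  obtain x y where xy: "x \<in> carrier G" "y \<in> carrier G" "x \<otimes> y \<noteq> y \<otimes> x"
    using nonab group_comm_groupI by blast
  have C: "subgroup (centralizer_of G u) G" "centralizer_of G u \<subseteq> carrier G" if "u \<in> carrier G" for u
    using that subgroup_centralizer_of by (auto simp: centralizer_of_def)
  have Z_eq: "Z = carrier G \<inter> \<Inter> (centralizer_of G ` carrier G)"
    by (simp add: Z_def centralizer_of_def set_eq_iff) metis
  have "subgroup (\<Inter> (centralizer_of G ` carrier G)) G"
    using C(1) by (intro subgroups_Inter) auto
  then have "subgroup Z G"
    unfolding Z_eq by (simp add: Int_absorb1 subgroup.subset)
  moreover have "x \<notin> Z" "x \<in> centralizer_of G x"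
    using xy by (auto simp: Z_def centralizer_of_def)
  then have "Z \<subset> centralizer_of G x" using Z_eq xy(1) by blast
  ultimately have Z1: "2 * card Z \<le> card (centralizer_of G x)"
    using C xy fin by (intro twice_card_proper_subgroup_le) auto
  have half: "2 * card (centralizer_of G u) \<le> ?n" if "u \<in> carrier G - Z" for u
    using that C[of u] fin subgroup_self by (intro twice_card_proper_subgroup_le) (auto simp: Z_def)
  have "x \<notin> Z" using xy by (auto simp: Z_def centralizer_of_def)
  then have Z4: "4 * card Z \<le> ?n" using Z1 half[of x] xy by simp
  have finZ: "finite Z" and ZG: "Z \<subseteq> carrier G" using fin by (auto simp: Z_def)
  have "2 * card (commutator_fibre G \<one>) = (\<Sum>u\<in>carrier G. 2 * card (centralizer_of G u))"
    by (simp add: card_commutator_fibre_one[OF fin] sum_distrib_left)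
  also have "\<dots> = (\<Sum>u\<in>carrier G - Z. 2 * card (centralizer_of G u)) + (\<Sum>u\<in>Z. 2 * card (centralizer_of G u))"
    using sum.subset_diff[OF ZG fin] by blast
  also have "\<dots> \<le> (\<Sum>u\<in>carrier G - Z. ?n) + (\<Sum>u\<in>Z. 2 * ?n)"
    by (intro add_mono sum_mono half) (auto simp: Z_def)
  also have "\<dots> = ?n * ?n + card Z * ?n"
    using ZG finZ card_mono[OF fin ZG] by (simp add: card_Diff_subset algebra_simps)
  finally have "8 * card (commutator_fibre G \<one>) \<le> 4 * ?n * ?n + 4 * card Z * ?n"
    by simp
  also have "\<dots> \<le> 5 * ?n ^ 2"
    using mult_right_mono[OF Z4, of ?n] by (simp add: power2_eq_square)
  finally show ?thesis .
qed

section \<open>One commutator hidden in an equation of words\<close>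

lemma (in group) inv_cancel_left [simp]:
  "x \<in> carrier G \<Longrightarrow> y \<in> carrier G \<Longrightarrow> x \<otimes> (inv x \<otimes> y) = y"
  "x \<in> carrier G \<Longrightarrow> y \<in> carrier G \<Longrightarrow> inv x \<otimes> (x \<otimes> y) = y"
  by (simp_all add: m_assoc[symmetric])

lemma (in group) conjugate_eq_one_iff:
  assumes "x \<in> carrier G" "g \<in> carrier G"
  shows "x \<otimes> g \<otimes> inv x = \<one> \<longleftrightarrow> g = \<one>"
proof -
  have "x \<otimes> g \<otimes> inv x = \<one> \<longleftrightarrow> x \<otimes> g \<otimes> inv x = x \<otimes> inv x" using assms by simp
  also have "\<dots> \<longleftrightarrow> x \<otimes> g = x" using assms by (subst right_cancel) auto
  finally show ?thesis using assms by simp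
qed

text \<open>The substitution \<open>u = v s q\<close>, \<open>w = (v p t)\<^sup>-\<^sup>1\<close> turns the equation in the unknowns \<open>p, q\<close> into a
  prescribed value of one commutator. The unknowns \<open>p\<close>, \<open>q\<close> are the values of the letters \<open>x\<close> and \<open>y\<close>;
  the factor \<open>q\<^sup>-\<^sup>1\<close> comes from eliminating the letter following \<open>y\<close>.\<close>

lemma (in group) card_two_letter_solutions:
  assumes [simp]: "b \<in> carrier G" "s \<in> carrier G" "v \<in> carrier G" "t \<in> carrier G" "d \<in> carrier G"
  defines "\<gamma> \<equiv> v \<otimes> s \<otimes> d \<otimes> inv b \<otimes> t"
  shows "card {(p, q) \<in> carrier G \<times> carrier G.
             p \<otimes> b = s \<otimes> q \<otimes> v \<otimes> p \<otimes> t \<otimes> inv q \<otimes> d} = card (commutator_fibre G \<gamma>)"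
proof -
  have \<gamma>: "\<gamma> \<in> carrier G" by (simp add: \<gamma>_def)
  have eqv: "p \<otimes> b = s \<otimes> q \<otimes> v \<otimes> p \<otimes> t \<otimes> inv q \<otimes> d \<longleftrightarrow>
      (v \<otimes> s \<otimes> q) \<otimes> inv (v \<otimes> p \<otimes> t) = \<gamma> \<otimes> inv (v \<otimes> p \<otimes> t) \<otimes> (v \<otimes> s \<otimes> q)"
    if [simp]: "p \<in> carrier G" "q \<in> carrier G" for p q
  proof -
    let ?u = "v \<otimes> s \<otimes> q" let ?w = "v \<otimes> p \<otimes> t"
    have "p \<otimes> b = s \<otimes> q \<otimes> v \<otimes> p \<otimes> t \<otimes> inv q \<otimes> d \<longleftrightarrow>
        v \<otimes> (p \<otimes> b) = v \<otimes> (s \<otimes> q \<otimes> v \<otimes> p \<otimes> t \<otimes> inv q \<otimes> d)"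
      by simp
    also have "v \<otimes> (p \<otimes> b) = ?w \<otimes> (inv t \<otimes> b)" by (simp add: m_assoc)
    also have "v \<otimes> (s \<otimes> q \<otimes> v \<otimes> p \<otimes> t \<otimes> inv q \<otimes> d) = ?u \<otimes> ?w \<otimes> inv ?u \<otimes> \<gamma> \<otimes> (inv t \<otimes> b)"
      by (simp add: m_assoc inv_mult_group \<gamma>_def)
    also have "?w \<otimes> (inv t \<otimes> b) = \<dots> \<longleftrightarrow> ?w = ?u \<otimes> ?w \<otimes> inv ?u \<otimes> \<gamma>"
      using \<gamma> by (subst right_cancel) auto
    also have "\<dots> \<longleftrightarrow> (?u \<otimes> inv ?w \<otimes> inv ?u) \<otimes> ?w = (?u \<otimes> inv ?w \<otimes> inv ?u) \<otimes> (?u \<otimes> ?w \<otimes> inv ?u \<otimes> \<gamma>)"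
      using \<gamma> by (subst Units_l_cancel) auto
    also have "(?u \<otimes> inv ?w \<otimes> inv ?u) \<otimes> (?u \<otimes> ?w \<otimes> inv ?u \<otimes> \<gamma>) = \<gamma>"
      using \<gamma> by (simp add: m_assoc inv_mult_group)
    also have "(?u \<otimes> inv ?w \<otimes> inv ?u) \<otimes> ?w = \<gamma> \<longleftrightarrow>
        (?u \<otimes> inv ?w \<otimes> inv ?u) \<otimes> ?w \<otimes> (inv ?w \<otimes> ?u) = \<gamma> \<otimes> (inv ?w \<otimes> ?u)"
      using \<gamma> by (subst right_cancel) auto
    also have "(?u \<otimes> inv ?w \<otimes> inv ?u) \<otimes> ?w \<otimes> (inv ?w \<otimes> ?u) = ?u \<otimes> inv ?w"
      by (simp add: m_assoc inv_mult_group)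
    finally show ?thesis using \<gamma> by (simp add: m_assoc)
  qed
  let ?A = "{(p, q) \<in> carrier G \<times> carrier G. p \<otimes> b = s \<otimes> q \<otimes> v \<otimes> p \<otimes> t \<otimes> inv q \<otimes> d}"
  define f where "f = (\<lambda>(p, q). (v \<otimes> s \<otimes> q, inv (v \<otimes> p \<otimes> t)))"
  define g where "g = (\<lambda>(u, w). (inv v \<otimes> inv w \<otimes> inv t, inv s \<otimes> inv v \<otimes> u))"
  have A_iff: "f pq \<in> commutator_fibre G \<gamma> \<longleftrightarrow> pq \<in> ?A" if "pq \<in> carrier G \<times> carrier G" for pq
    using that by (cases pq) (simp add: f_def commutator_fibre_def eqv)
  have gf: "g (f pq) = pq" and fg: "f (g pq) = pq" and g_closed: "g pq \<in> carrier G \<times> carrier G"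
    if "pq \<in> carrier G \<times> carrier G" for pq
    using that by (cases pq; simp add: f_def g_def m_assoc inv_mult_group)+
  have F: "commutator_fibre G \<gamma> \<subseteq> carrier G \<times> carrier G" by (auto simp: commutator_fibre_def)
  have "bij_betw f ?A (commutator_fibre G \<gamma>)"
  proof (rule bij_betw_byWitness[where f' = g])
    show "f ` ?A \<subseteq> commutator_fibre G \<gamma>" using A_iff by blast
    show "g ` commutator_fibre G \<gamma> \<subseteq> ?A"
    proof (rule image_subsetI)
      fix uw assume "uw \<in> commutator_fibre G \<gamma>"
      then show "g uw \<in> ?A" using A_iff[OF g_closed, of uw] fg[of uw] F by auto
    qed
  qed (use gf fg F in auto)
  then show ?thesis by (rule bij_betw_same_card)
qed


section \<open>Probability that two words take the same value\<close>

definition word_eq_prob :: "('a, 'b) monoid_scheme \<Rightarrow> 'i set \<Rightarrow> 'i list \<Rightarrow> 'i list \<Rightarrow> real" where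
  "word_eq_prob G I u w =
     card {a \<in> I \<rightarrow>\<^sub>E carrier G. list_prod G (map a u) = list_prod G (map a w)} / card (carrier G) ^ card I"

lemma card_eq_sum_of_bool:
  "finite A \<Longrightarrow> real (card {a \<in> A. P a}) = (\<Sum>a\<in>A. of_bool (P a))"
  by (simp add: sum_of_bool_eq Int_def conj_commute)

lemma sum_PiE_insert:
  fixes h :: "('i \<Rightarrow> 'a) \<Rightarrow> 'c::comm_monoid_add"
  assumes "x \<notin> S"
  shows "(\<Sum>a\<in>insert x S \<rightarrow>\<^sub>E A. h a) = (\<Sum>b\<in>S \<rightarrow>\<^sub>E A. \<Sum>p\<in>A. h (b(x := p)))"
proof -
  have "(\<Sum>a\<in>insert x S \<rightarrow>\<^sub>E A. h a) = (\<Sum>(p, b)\<in>A \<times> (S \<rightarrow>\<^sub>E A). h (b(x := p)))"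
    unfolding PiE_insert_eq using inj_combinator[OF assms, of "\<lambda>_. A"]
    by (simp add: sum.reindex case_prod_unfold o_def)
  also have "\<dots> = (\<Sum>p\<in>A. \<Sum>b\<in>S \<rightarrow>\<^sub>E A. h (b(x := p)))"
    by (rule sum.cartesian_product[symmetric])
  finally show ?thesis by (subst sum.swap)
qed

lemma (in group) sum_left_translate:
  assumes "q \<in> carrier G"
  shows "(\<Sum>r\<in>carrier G. f r) = (\<Sum>d\<in>carrier G. f (inv q \<otimes> d))"
  by (rule sum.reindex_bij_witness[where i = "\<lambda>d. inv q \<otimes> d" and j = "\<lambda>r. q \<otimes> r"]) (use assms in auto)

text \<open>The value of \<open>z\<close> is parametrised by the product \<open>d\<close> of the values of \<open>y\<close> and \<open>z\<close>, so that a word in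
  which \<open>y z\<close> occurs as a factor does not depend on the value \<open>q\<close> of \<open>y\<close> once \<open>d\<close> is fixed.\<close>

lemma (in group) sum_three_letters:
  fixes h :: "('i \<Rightarrow> 'a) \<Rightarrow> real"
  assumes "x \<notin> insert y (insert z J)" "y \<notin> insert z J" "z \<notin> J"
  shows "(\<Sum>a\<in>insert x (insert y (insert z J)) \<rightarrow>\<^sub>E carrier G. h a) =
    (\<Sum>(b, d)\<in>(J \<rightarrow>\<^sub>E carrier G) \<times> carrier G. \<Sum>(p, q)\<in>carrier G \<times> carrier G.
       h (b(z := inv q \<otimes> d, y := q, x := p)))"
proof -
  let ?C = "carrier G"
  have "(\<Sum>a\<in>insert x (insert y (insert z J)) \<rightarrow>\<^sub>E ?C. h a) =
      (\<Sum>b\<in>J \<rightarrow>\<^sub>E ?C. \<Sum>r\<in>?C. \<Sum>q\<in>?C. \<Sum>p\<in>?C. h (b(z := r, y := q, x := p)))"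
    using assms by (simp add: sum_PiE_insert)
  also have "\<dots> = (\<Sum>b\<in>J \<rightarrow>\<^sub>E ?C. \<Sum>d\<in>?C. \<Sum>p\<in>?C. \<Sum>q\<in>?C. h (b(z := inv q \<otimes> d, y := q, x := p)))"
  proof (rule sum.cong[OF refl])
    fix b
    have "(\<Sum>r\<in>?C. \<Sum>q\<in>?C. \<Sum>p\<in>?C. h (b(z := r, y := q, x := p))) =
        (\<Sum>q\<in>?C. \<Sum>r\<in>?C. \<Sum>p\<in>?C. h (b(z := r, y := q, x := p)))"
      by (rule sum.swap)
    also have "\<dots> = (\<Sum>q\<in>?C. \<Sum>d\<in>?C. \<Sum>p\<in>?C. h (b(z := inv q \<otimes> d, y := q, x := p)))"
      by (intro sum.cong[OF refl] sum_left_translate)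
    also have "\<dots> = (\<Sum>d\<in>?C. \<Sum>q\<in>?C. \<Sum>p\<in>?C. h (b(z := inv q \<otimes> d, y := q, x := p)))"
      by (rule sum.swap)
    also have "\<dots> = (\<Sum>d\<in>?C. \<Sum>p\<in>?C. \<Sum>q\<in>?C. h (b(z := inv q \<otimes> d, y := q, x := p)))"
      by (intro sum.cong[OF refl] sum.swap)
    finally show "(\<Sum>r\<in>?C. \<Sum>q\<in>?C. \<Sum>p\<in>?C. h (b(z := r, y := q, x := p))) =
        (\<Sum>d\<in>?C. \<Sum>p\<in>?C. \<Sum>q\<in>?C. h (b(z := inv q \<otimes> d, y := q, x := p)))" .
  qed
  finally show ?thesis by (simp flip: sum.cartesian_product)
qed

text \<open>Averaging over the fixed data \<open>s\<close>: if \<open>\<gamma> s\<close> is trivial with probability at most \<open>1/2 + e\<close>, then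
  the excess over \<open>1/2\<close> of the probability of \<open>[u, w] = \<gamma> s\<close> is at most a quarter of \<open>e\<close>. The case
  distinction is needed since \<open>1 - c\<close> bounds the nontrivial fibres usefully only for \<open>c \<ge> 1/2\<close>.\<close>

lemma (in group) mean_commutator_fibre_le:
  fixes \<gamma> :: "'s \<Rightarrow> 'a" and e :: real
  assumes fin: "finite (carrier G)" and nonab: "\<not> comm_group G"
    and \<gamma>: "\<And>s. s \<in> S \<Longrightarrow> \<gamma> s \<in> carrier G"
    and S: "finite S" "S \<noteq> {}"
    and e: "0 \<le> e" "real (card {s \<in> S. \<gamma> s = \<one>}) \<le> (1/2 + e) * card S"
  shows "(\<Sum>s\<in>S. real (card (commutator_fibre G (\<gamma> s)))) \<le> (1/2 + e / 4) * card S * card (carrier G) ^ 2"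
proof -
  define M where "M = real (card S)"
  define N where "N = real (card (carrier G)) ^ 2"
  define c where "c = real (card (commutator_fibre G \<one>)) / N"
  define f where "f = real (card {s \<in> S. \<gamma> s = \<one>}) / M"
  have M: "M > 0" using S by (simp add: M_def card_gt_0_iff)
  have N: "N > 0" using fin by (auto simp: N_def card_gt_0_iff)
  have cN: "real (card (commutator_fibre G \<one>)) = c * N" using N by (simp add: c_def)
  have fM: "real (card {s \<in> S. \<gamma> s = \<one>}) = f * M" using M by (simp add: f_def)
  have c58: "c \<le> 5/8"
    using commuting_pairs_le_five_eighths[OF fin nonab] N
    by (simp add: c_def N_def field_simps flip: of_nat_power of_nat_mult)
  have f_le: "f \<le> 1/2 + e" using e M unfolding fM by (simp flip: M_def)
  show ?thesis
  proof (cases "c \<le> 1/2")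
    case True
    have "(\<Sum>s\<in>S. real (card (commutator_fibre G (\<gamma> s)))) \<le> (\<Sum>s\<in>S. c * N)"
      unfolding cN[symmetric] using card_commutator_fibre_le_one[OF fin] \<gamma> by (intro sum_mono) auto
    also have "\<dots> = c * M * N" by (simp add: M_def)
    also have "\<dots> \<le> (1/2 + e / 4) * M * N"
      using True M N e by (intro mult_right_mono) auto
    finally show ?thesis by (simp add: M_def N_def)
  next
    case False
    have "real (card (commutator_fibre G (\<gamma> s))) \<le> (1 - c) * N + of_bool (\<gamma> s = \<one>) * ((2 * c - 1) * N)"
      if "s \<in> S" for s
    proof (cases "\<gamma> s = \<one>")
      case False
      have "real (card (commutator_fibre G (\<gamma> s))) + real (card (commutator_fibre G \<one>)) \<le> N"
        using card_commutator_fibre_add_le[OF fin \<gamma>[OF that] False]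
        by (simp add: N_def flip: of_nat_power of_nat_add)
      then show ?thesis using False by (simp add: cN algebra_simps)
    qed (simp add: cN algebra_simps)
    then have "(\<Sum>s\<in>S. real (card (commutator_fibre G (\<gamma> s)))) \<le>
        (\<Sum>s\<in>S. (1 - c) * N + of_bool (\<gamma> s = \<one>) * ((2 * c - 1) * N))"
      by (rule sum_mono)
    also have "\<dots> = M * ((1 - c) * N) + (\<Sum>s\<in>S. of_bool (\<gamma> s = \<one>)) * ((2 * c - 1) * N)"
      by (simp add: sum.distrib M_def flip: sum_distrib_right)
    also have "\<dots> = ((1 - c) + f * (2 * c - 1)) * M * N"
      using fM card_eq_sum_of_bool[OF S(1), of "\<lambda>s. \<gamma> s = \<one>"] by (simp add: algebra_simps)
    also have "\<dots> \<le> (1/2 + e / 4) * M * N"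
    proof -
      have "f * (2 * c - 1) \<le> (1/2 + e) * (2 * c - 1)"
        using False f_le by (intro mult_right_mono) auto
      moreover have "e * (2 * c - 1) \<le> e * (1 / 4)"
        using c58 e by (intro mult_left_mono) auto
      ultimately have "(1 - c) + f * (2 * c - 1) \<le> 1/2 + e / 4" by (simp add: algebra_simps)
      then show ?thesis using M N by (intro mult_right_mono) auto
    qed
    finally show ?thesis by (simp add: M_def N_def)
  qed
qed

text \<open>Undoing the block transposition that makes \<open>x\<close> follow \<open>P\<close> and \<open>z\<close> follow \<open>y\<close>. In the sorted word
  \<open>P x L y z R\<close> these pairs are adjacent as well; hence after the move both sides depend on \<open>y, z\<close> only
  through their product and \<open>x\<close> cancels, while before the move the letters \<open>x\<close> and \<open>y\<close> contribute
  one commutator.\<close>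

lemma (in group) word_eq_prob_undo_move:
  fixes e :: real
  assumes fin: "finite (carrier G)" and nonab: "\<not> comm_group G"
    and J: "finite J" and xyz: "x \<notin> insert y (insert z J)" "y \<notin> insert z J" "z \<notin> J"
    and sub: "set P \<subseteq> J" "set L \<subseteq> J" "set R \<subseteq> J" "set A \<subseteq> J" "set V \<subseteq> J" "set B \<subseteq> J" "set T \<subseteq> J"
    and e: "0 \<le> e"
      "word_eq_prob G (insert x (insert y (insert z J))) (P @ x # L @ y # z # R)
         (P @ x # B @ V @ A @ y # z # T) \<le> 1/2 + e"
  shows "word_eq_prob G (insert x (insert y (insert z J))) (P @ x # L @ y # z # R)
           (P @ A @ y # V @ x # B @ z # T) \<le> 1/2 + e / 4"
proof -
  let ?C = "carrier G"
  let ?I = "insert x (insert y (insert z J))"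
  let ?S = "(J \<rightarrow>\<^sub>E ?C) \<times> ?C"
  define va where "va b w = list_prod G (map b w)" for b :: "'c \<Rightarrow> 'a" and w
  \<comment> \<open>Values of the fixed parts, and the prescribed commutator they determine.\<close>
  define \<beta> where "\<beta> b d = va b L \<otimes> d \<otimes> va b R" for b d
  define \<delta> where "\<delta> b d = d \<otimes> va b T" for b d
  define \<gamma> where "\<gamma> = (\<lambda>(b, d). va b V \<otimes> va b A \<otimes> \<delta> b d \<otimes> inv (\<beta> b d) \<otimes> va b B)"
  define upd where "upd b d p q = b(z := inv q \<otimes> d, y := q, x := p)" for b :: "'c \<Rightarrow> 'a" and d p q
  have va_closed: "va b w \<in> ?C" if "b \<in> J \<rightarrow>\<^sub>E ?C" "set w \<subseteq> J" for b w
    unfolding va_def using that by (intro list_prod_closed) (auto dest: PiE_mem)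
  have va_upd: "va (upd b d p q) w = va b w" if "set w \<subseteq> J" for b d p q w
    unfolding va_def upd_def using that xyz by (intro arg_cong[where f = "list_prod G"]) auto
  have va_append: "va a (v @ w) = va a v \<otimes> va a w"
    if "a \<in> ?I \<rightarrow>\<^sub>E ?C" "set v \<subseteq> ?I" "set w \<subseteq> ?I" for a v w
    unfolding va_def map_append using that by (intro list_prod_append) (auto dest: PiE_mem)
  have va_Cons: "va a (i # w) = a i \<otimes> va a w" for a i w
    by (simp add: va_def)
  have upd_mem: "upd b d p q \<in> ?I \<rightarrow>\<^sub>E ?C"
    if "b \<in> J \<rightarrow>\<^sub>E ?C" "d \<in> ?C" "q \<in> ?C" "p \<in> ?C" for b d q p
    using that by (auto simp: upd_def PiE_def extensional_def Pi_def)
  have upd_xyz: "upd b d p q x = p" "upd b d p q y = q" "upd b d p q z = inv q \<otimes> d" for b d p q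
    using xyz by (auto simp: upd_def)
  have subI: "set w \<subseteq> ?I" if "set w \<subseteq> J" for w using that by auto
  note subI = sub[THEN subI]
  have \<gamma>_closed: "\<gamma> s \<in> ?C" if "s \<in> ?S" for s
    using that sub by (auto simp: \<gamma>_def \<beta>_def \<delta>_def va_closed)
  have old: "va (upd b d p q) (P @ x # L @ y # z # R) = va (upd b d p q) (P @ A @ y # V @ x # B @ z # T) \<longleftrightarrow>
       p \<otimes> \<beta> b d = va b A \<otimes> q \<otimes> va b V \<otimes> p \<otimes> va b B \<otimes> inv q \<otimes> \<delta> b d"
    and new: "va (upd b d p q) (P @ x # L @ y # z # R) = va (upd b d p q) (P @ x # B @ V @ A @ y # z # T) \<longleftrightarrow>
       \<gamma> (b, d) = \<one>"
    if bd: "b \<in> J \<rightarrow>\<^sub>E ?C" "d \<in> ?C" "p \<in> ?C" "q \<in> ?C" for b d p q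
  proof -
    note [simp] = va_closed[OF bd(1)] va_append[OF upd_mem[OF bd(1,2,4,3)]] va_Cons va_upd upd_xyz sub subI bd
    have [simp]: "\<beta> b d \<in> ?C" "\<delta> b d \<in> ?C" by (simp_all add: \<beta>_def \<delta>_def)
    have u: "va (upd b d p q) (P @ x # L @ y # z # R) = va b P \<otimes> (p \<otimes> \<beta> b d)"
      by (simp add: \<beta>_def m_assoc)
    have w: "va (upd b d p q) (P @ A @ y # V @ x # B @ z # T) =
        va b P \<otimes> (va b A \<otimes> q \<otimes> va b V \<otimes> p \<otimes> va b B \<otimes> inv q \<otimes> \<delta> b d)"
      by (simp add: \<delta>_def m_assoc)
    have w': "va (upd b d p q) (P @ x # B @ V @ A @ y # z # T) =
        va b P \<otimes> (p \<otimes> (va b B \<otimes> (va b V \<otimes> va b A \<otimes> \<delta> b d)))"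
      by (simp add: \<delta>_def m_assoc)
    show "va (upd b d p q) (P @ x # L @ y # z # R) = va (upd b d p q) (P @ A @ y # V @ x # B @ z # T) \<longleftrightarrow>
       p \<otimes> \<beta> b d = va b A \<otimes> q \<otimes> va b V \<otimes> p \<otimes> va b B \<otimes> inv q \<otimes> \<delta> b d"
      unfolding u w by simp
    have "\<gamma> (b, d) = \<one> \<longleftrightarrow> va b B \<otimes> \<gamma> (b, d) \<otimes> inv (va b B) = \<one>"
      using \<gamma>_closed[of "(b, d)"] by (simp add: conjugate_eq_one_iff)
    also have "va b B \<otimes> \<gamma> (b, d) \<otimes> inv (va b B) =
        va b B \<otimes> (va b V \<otimes> va b A \<otimes> \<delta> b d) \<otimes> inv (\<beta> b d)"
      by (simp add: \<gamma>_def m_assoc)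
    also have "\<dots> = \<one> \<longleftrightarrow> \<beta> b d = va b B \<otimes> (va b V \<otimes> va b A \<otimes> \<delta> b d)"
      by (subst inv_solve_right') auto
    finally show "va (upd b d p q) (P @ x # L @ y # z # R) = va (upd b d p q) (P @ x # B @ V @ A @ y # z # T) \<longleftrightarrow>
       \<gamma> (b, d) = \<one>"
      unfolding u w' by simp
  qed
  have finC: "finite (?C \<times> ?C)" and finS: "finite ?S" and finI: "finite (?I \<rightarrow>\<^sub>E ?C)"
    using fin J by (auto intro!: finite_PiE)
  have count: "real (card {a \<in> ?I \<rightarrow>\<^sub>E ?C. va a u = va a w}) =
      (\<Sum>(b, d)\<in>?S. real (card {pq \<in> ?C \<times> ?C. va (upd b d (fst pq) (snd pq)) u = va (upd b d (fst pq) (snd pq)) w}))" for u w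
    unfolding card_eq_sum_of_bool[OF finI] card_eq_sum_of_bool[OF finC] sum_three_letters[OF xyz] upd_def
    by (simp add: case_prod_unfold)
  have prob: "word_eq_prob G ?I u w =
      real (card {a \<in> ?I \<rightarrow>\<^sub>E ?C. va a u = va a w}) / (card ?S * card ?C ^ 2)" for u w
    using xyz J fin
    by (simp add: word_eq_prob_def va_def card_cartesian_product card_funcsetE power2_eq_square ac_simps)
  have old_count: "real (card {a \<in> ?I \<rightarrow>\<^sub>E ?C. va a (P @ x # L @ y # z # R) = va a (P @ A @ y # V @ x # B @ z # T)}) =
      (\<Sum>s\<in>?S. real (card (commutator_fibre G (\<gamma> s))))"
    unfolding count
  proof (rule sum.cong[OF refl], clarify)
    fix b d assume bd: "b \<in> J \<rightarrow>\<^sub>E ?C" "d \<in> ?C"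
    have "{pq \<in> ?C \<times> ?C. va (upd b d (fst pq) (snd pq)) (P @ x # L @ y # z # R) =
          va (upd b d (fst pq) (snd pq)) (P @ A @ y # V @ x # B @ z # T)} =
        {(p, q) \<in> ?C \<times> ?C. p \<otimes> \<beta> b d = va b A \<otimes> q \<otimes> va b V \<otimes> p \<otimes> va b B \<otimes> inv q \<otimes> \<delta> b d}"
      using old[OF bd] by auto
    then show "real (card {pq \<in> ?C \<times> ?C. va (upd b d (fst pq) (snd pq)) (P @ x # L @ y # z # R) =
          va (upd b d (fst pq) (snd pq)) (P @ A @ y # V @ x # B @ z # T)}) =
        real (card (commutator_fibre G (\<gamma> (b, d))))"
      using card_two_letter_solutions[of "\<beta> b d" "va b A" "va b V" "va b B" "\<delta> b d"] bd sub
      by (simp add: \<gamma>_def va_closed) (simp add: \<beta>_def \<delta>_def va_closed)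
  qed
  have "real (card {a \<in> ?I \<rightarrow>\<^sub>E ?C. va a (P @ x # L @ y # z # R) = va a (P @ x # B @ V @ A @ y # z # T)}) =
      (\<Sum>s\<in>?S. of_bool (\<gamma> s = \<one>) * real (card ?C ^ 2))"
    unfolding count
  proof (rule sum.cong[OF refl], clarify)
    fix b d assume bd: "b \<in> J \<rightarrow>\<^sub>E ?C" "d \<in> ?C"
    have "{pq \<in> ?C \<times> ?C. va (upd b d (fst pq) (snd pq)) (P @ x # L @ y # z # R) =
          va (upd b d (fst pq) (snd pq)) (P @ x # B @ V @ A @ y # z # T)} =
        (if \<gamma> (b, d) = \<one> then ?C \<times> ?C else {})"
      using new[OF bd] by auto
    then show "real (card {pq \<in> ?C \<times> ?C. va (upd b d (fst pq) (snd pq)) (P @ x # L @ y # z # R) =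
          va (upd b d (fst pq) (snd pq)) (P @ x # B @ V @ A @ y # z # T)}) =
        of_bool (\<gamma> (b, d) = \<one>) * real (card ?C ^ 2)"
      by (simp add: card_cartesian_product power2_eq_square)
  qed
  also have "\<dots> = real (card {s \<in> ?S. \<gamma> s = \<one>}) * real (card ?C ^ 2)"
    unfolding card_eq_sum_of_bool[OF finS] by (rule sum_distrib_right[symmetric])
  finally have new_count: "real (card {a \<in> ?I \<rightarrow>\<^sub>E ?C. va a (P @ x # L @ y # z # R) = va a (P @ x # B @ V @ A @ y # z # T)}) =
      real (card {s \<in> ?S. \<gamma> s = \<one>}) * real (card ?C ^ 2)" .
  have neS: "?S \<noteq> {}" by (auto simp: PiE_eq_empty_iff)
  have posS: "real (card ?S) > 0" using finS neS by (simp only: card_gt_0_iff of_nat_0_less_iff) simp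
  have posC: "real (card ?C ^ 2) > 0" using fin by (auto simp: card_gt_0_iff)
  have "real (card {s \<in> ?S. \<gamma> s = \<one>}) \<le> (1/2 + e) * card ?S"
    using e(2) posS posC unfolding prob new_count by (simp add: field_simps del: card_cartesian_product)
  then have "(\<Sum>s\<in>?S. real (card (commutator_fibre G (\<gamma> s)))) \<le> (1/2 + e / 4) * card ?S * card ?C ^ 2"
    by (intro mean_commutator_fibre_le[OF fin nonab \<gamma>_closed finS neS e(1)])
  then show ?thesis
    using posS posC unfolding prob old_count by (simp add: field_simps del: card_cartesian_product)
qed


text \<open>A common final letter cancels. This is used to supply the letter \<open>y + 1\<close> when \<open>y = n\<close>.\<close>

lemma (in group) word_eq_prob_append_fresh:
  assumes fin: "finite (carrier G)" and I: "finite I" "z \<notin> I" "set u \<subseteq> I" "set w \<subseteq> I"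
  shows "word_eq_prob G (insert z I) (u @ [z]) (w @ [z]) = word_eq_prob G I u w"
proof -
  let ?C = "carrier G"
  have finI: "finite (J \<rightarrow>\<^sub>E ?C)" if "finite J" for J :: "'c set"
    using fin that by (auto intro!: finite_PiE)
  have "list_prod G (map (b(z := p)) (v @ [z])) = list_prod G (map b v) \<otimes> p"
    and "list_prod G (map b v) \<in> ?C"
    if "b \<in> I \<rightarrow>\<^sub>E ?C" "p \<in> ?C" "set v \<subseteq> I" for b p v
  proof -
    have sub: "set (map b v) \<subseteq> ?C" using that by (auto dest: PiE_mem)
    then show "list_prod G (map b v) \<in> ?C" by simp
    have upd: "map (b(z := p)) (v @ [z]) = map b v @ [p]" using that I(2) by auto
    show "list_prod G (map (b(z := p)) (v @ [z])) = list_prod G (map b v) \<otimes> p"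
      unfolding upd using sub that by (simp add: list_prod_append)
  qed
  then have "(\<Sum>p\<in>?C. of_bool (list_prod G (map (b(z := p)) (u @ [z])) = list_prod G (map (b(z := p)) (w @ [z]))))
      = (\<Sum>p\<in>?C. of_bool (list_prod G (map b u) = list_prod G (map b w)) :: real)"
    if "b \<in> I \<rightarrow>\<^sub>E ?C" for b
    using that I by (intro sum.cong) auto
  then have "real (card {a \<in> insert z I \<rightarrow>\<^sub>E ?C. list_prod G (map a (u @ [z])) = list_prod G (map a (w @ [z]))})
      = card ?C * real (card {b \<in> I \<rightarrow>\<^sub>E ?C. list_prod G (map b u) = list_prod G (map b w)})"
    using I by (simp add: card_eq_sum_of_bool[OF finI] sum_PiE_insert sum_distrib_left del: map_append)
  moreover have "card ?C > 0" using fin by (auto simp: card_gt_0_iff)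
  ultimately show ?thesis
    using I by (simp add: word_eq_prob_def)
qed

section \<open>Block transpositions\<close>

lemma upt_split: "i \<le> j \<Longrightarrow> j \<le> k \<Longrightarrow> [i..<k] = [i..<j] @ [j..<k]" for i j k :: nat
  using upt_add_eq_append[of i j "k - j"] by simp

lemma block_transposition_exists:
  assumes "1 \<le> p" "p \<le> q" "q < r" "r \<le> s" "s \<le> n"
  obtains \<tau> where "block_transposition n \<tau>"
    "map \<tau> [1..<Suc n] = [1..<p] @ [r..<Suc s] @ [Suc q..<r] @ [p..<Suc q] @ [Suc s..<Suc n]"
proof -
  define L where "L = [1..<p] @ [r..<Suc s] @ [Suc q..<r] @ [p..<Suc q] @ [Suc s..<Suc n]"
  have set_L: "set L = {1..n}" and dist_L: "distinct L" and len_L: "length L = n"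
    using assms by (auto simp: L_def simp del: upt_Suc)
  define \<tau> where "\<tau> i = (if i \<in> {1..n} then L ! (i - 1) else i)" for i
  have map_\<tau>: "map \<tau> [1..<Suc n] = L"
    by (rule nth_equalityI) (auto simp: len_L \<tau>_def simp del: upt_Suc)
  have "set [1..<Suc n] = {1..n}" by auto
  then have "bij_betw \<tau> {1..n} {1..n}"
    unfolding bij_betw_def using map_\<tau> set_L dist_L by (metis distinct_map list.set_map)
  then have "\<tau> permutes {1..n}" by (rule bij_imp_permutes) (auto simp: \<tau>_def)
  then show ?thesis
    using that[of \<tau>] assms map_\<tau> unfolding L_def block_transposition_def sym_group_carrier by blast
qed

text \<open>The blocks of the inverse occupy the positions to which the original blocks were moved: their
  lengths are exchanged, while the length of the middle part stays the same.\<close>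

lemma block_transposition_inv:
  assumes "block_transposition n \<tau>"
  shows "block_transposition n (inv' \<tau>)"
proof -
  from assms obtain p q r s where pqrs: "1 \<le> p" "p \<le> q" "q < r" "r \<le> s" "s \<le> n"
    and perm: "\<tau> permutes {1..n}"
    and map_\<tau>: "map \<tau> [1..<Suc n] = [1..<p] @ [r..<Suc s] @ [Suc q..<r] @ [p..<Suc q] @ [Suc s..<Suc n]"
    unfolding block_transposition_def sym_group_carrier by blast
  define q' where "q' = p + (s - r)"
  define r' where "r' = p + (s - q)"
  have q'r': "p \<le> q'" "q' < r'" "r' \<le> s" using pqrs by (auto simp: q'_def r'_def)
  have "[1..<Suc n] = [1..<p] @ [p..<Suc q'] @ [Suc q'..<r'] @ [r'..<Suc s] @ [Suc s..<Suc n]"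
    using pqrs q'r' upt_split[of 1 p "Suc n"] upt_split[of p "Suc q'" "Suc n"]
      upt_split[of "Suc q'" r' "Suc n"] upt_split[of r' "Suc s" "Suc n"]
    by (simp del: upt_Suc)
  then have "map \<tau> ([1..<p] @ [p..<Suc q'] @ [Suc q'..<r'] @ [r'..<Suc s] @ [Suc s..<Suc n]) =
      [1..<p] @ [r..<Suc s] @ [Suc q..<r] @ [p..<Suc q] @ [Suc s..<Suc n]"
    using map_\<tau> by metis
  then have eqs: "map \<tau> [1..<p] = [1..<p]" "map \<tau> [p..<Suc q'] = [r..<Suc s]"
      "map \<tau> [Suc q'..<r'] = [Suc q..<r]" "map \<tau> [r'..<Suc s] = [p..<Suc q]"
      "map \<tau> [Suc s..<Suc n] = [Suc s..<Suc n]"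
    unfolding map_append using pqrs by (auto simp: append_eq_append_conv q'_def r'_def simp del: upt_Suc)
  have "[1..<Suc n] = [1..<p] @ [p..<Suc q] @ [Suc q..<r] @ [r..<Suc s] @ [Suc s..<Suc n]"
    using pqrs upt_split[of 1 p "Suc n"] upt_split[of p "Suc q" "Suc n"]
      upt_split[of "Suc q" r "Suc n"] upt_split[of r "Suc s" "Suc n"]
    by (simp del: upt_Suc)
  also have "\<dots> = map \<tau> ([1..<p] @ [r'..<Suc s] @ [Suc q'..<r'] @ [p..<Suc q'] @ [Suc s..<Suc n])"
    unfolding map_append eqs ..
  finally have "map (inv' \<tau>) [1..<Suc n] =
      map (inv' \<tau>) (map \<tau> ([1..<p] @ [r'..<Suc s] @ [Suc q'..<r'] @ [p..<Suc q'] @ [Suc s..<Suc n]))"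
    by (rule arg_cong)
  also have "\<dots> = [1..<p] @ [r'..<Suc s] @ [Suc q'..<r'] @ [p..<Suc q'] @ [Suc s..<Suc n]"
    unfolding map_map permutes_inv_o(2)[OF perm] by simp
  finally show ?thesis
    using permutes_inv[OF perm] pqrs q'r' unfolding block_transposition_def sym_group_carrier by blast
qed

text \<open>The interchanged blocks run from position \<open>x\<close> to the position of \<open>y\<close>, the largest value before
  \<open>x\<close>, and from the position of \<open>x\<close> to just before that of \<open>y + 1\<close>. Maximality of \<open>y\<close> places \<open>y + 1\<close>
  to the right of \<open>x\<close>; if \<open>y = n\<close>, then \<open>y + 1\<close> is the fixed point at position \<open>n + 1\<close>, which is why the
  sequences are taken up to \<open>n + 1\<close>.\<close>

lemma block_transposition_fixing_next:
  assumes \<sigma>: "\<sigma> \<in> carrier (sym_group n)" and fixed: "\<And>i. i < x \<Longrightarrow> \<sigma> i = i" and moved: "\<sigma> x \<noteq> x"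
  obtains \<tau> y A V B T where "block_transposition n \<tau>" "1 \<le> x" "x < y" "y \<le> n"
    "map \<sigma> [1..<n + 2] = [1..<x] @ A @ y # V @ x # B @ Suc y # T"
    "map (\<sigma> \<circ> \<tau>) [1..<n + 2] = [1..<x] @ x # B @ V @ A @ y # Suc y # T"
proof -
  have perm: "\<sigma> permutes {1..n}" using \<sigma> by (simp add: sym_group_carrier)
  then have inj: "inj \<sigma>" by (rule permutes_inj)
  have x1: "1 \<le> x" "x \<le> n" using permutes_not_in[OF perm, of x] moved by auto
  have ge: "x \<le> \<sigma> i" if "x \<le> i" for i
  proof (rule ccontr)
    assume "\<not> x \<le> \<sigma> i"
    then have "\<sigma> (\<sigma> i) = \<sigma> i" by (intro fixed) simp
    then show False using inj that \<open>\<not> x \<le> \<sigma> i\<close> by (simp add: inj_eq)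
  qed
  obtain r where r: "\<sigma> r = x" using permutes_surj[OF perm] by (metis surjD)
  have xr: "x < r" using r fixed moved by (metis linorder_neqE_nat less_irrefl)
  have rn: "r \<le> n" using r xr x1 permutes_not_in[OF perm, of r] by auto
  define y where "y = Max (\<sigma> ` {x..<r})"
  have "y \<in> \<sigma> ` {x..<r}" unfolding y_def using xr by (intro Max_in) auto
  then obtain q where q: "\<sigma> q = y" "x \<le> q" "q < r" by auto
  have ymax: "\<sigma> i \<le> y" if "x \<le> i" "i < r" for i
    unfolding y_def using that by (intro Max_ge) auto
  have xy: "x < y" using ymax[of x] ge[of x] moved xr by simp
  have yn: "y \<le> n" using permutes_in_image[OF perm, of q] q rn x1 by auto
  obtain c where c: "\<sigma> c = Suc y" using permutes_surj[OF perm] by (metis surjD)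
  have rc: "r < c"
  proof (rule ccontr)
    assume "\<not> r < c"
    moreover have "c \<noteq> r" using c r xy by auto
    moreover have "x \<le> c" using fixed[of c] c xy by (metis Suc_lessD leI not_less_eq order_less_imp_not_less)
    ultimately show False using ymax[of c] c by simp
  qed
  have cn: "c \<le> Suc n" using permutes_not_in[OF perm, of c] c yn by (cases "c \<in> {1..n}") auto
  obtain s where s: "c = Suc s" using rc by (cases c) auto
  obtain \<tau> where \<tau>: "block_transposition n \<tau>"
      "map \<tau> [1..<Suc n] = [1..<x] @ [r..<Suc s] @ [Suc q..<r] @ [x..<Suc q] @ [Suc s..<Suc n]"
    using block_transposition_exists[of x q r s n] x1 q rc cn s by auto
  have "\<tau> permutes {1..n}" using \<tau>(1) by (simp add: block_transposition_def sym_group_carrier)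
  then have "\<tau> (Suc n) = Suc n" by (simp add: permutes_not_in)
  then have \<tau>': "map \<tau> [1..<n + 2] = [1..<x] @ [r..<c] @ [Suc q..<r] @ [x..<Suc q] @ [c..<n + 2]"
    using \<tau>(2) s cn x1 upt_split[of c "Suc n" "n + 2"] upt_split[of 1 "Suc n" "n + 2"]
    by (simp add: upt_conv_Cons del: upt_Suc)
  have \<sigma>_prefix: "map \<sigma> [1..<x] = [1..<x]" by (rule map_idI) (simp add: fixed)
  have split: "[1..<n + 2] = [1..<x] @ [x..<q] @ q # [Suc q..<r] @ r # [Suc r..<c] @ c # [Suc c..<n + 2]"
    using q xr rc cn x1 upt_split[of 1 x "n + 2"] upt_split[of x q "n + 2"] upt_split[of "Suc q" r "n + 2"]
      upt_split[of "Suc r" c "n + 2"]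
    by (simp add: upt_conv_Cons del: upt_Suc)
  have 1: "map \<sigma> [1..<n + 2] = [1..<x] @ map \<sigma> [x..<q] @ y # map \<sigma> [Suc q..<r] @ x # map \<sigma> [Suc r..<c]
      @ Suc y # map \<sigma> [Suc c..<n + 2]"
    unfolding split map_append list.map \<sigma>_prefix q(1) r c ..
  have split': "[r..<c] = r # [Suc r..<c]" "[x..<Suc q] = [x..<q] @ [q]" "[c..<n + 2] = c # [Suc c..<n + 2]"
    using q rc cn by (auto simp: upt_conv_Cons)
  have "map (\<sigma> \<circ> \<tau>) [1..<n + 2] = map \<sigma> (map \<tau> [1..<n + 2])" by simp
  also have "\<dots> = [1..<x] @ x # map \<sigma> [Suc r..<c] @ map \<sigma> [Suc q..<r] @ map \<sigma> [x..<q] @ y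
      # Suc y # map \<sigma> [Suc c..<n + 2]"
    unfolding \<tau>' split' map_append list.map \<sigma>_prefix q(1) r c by simp
  finally show ?thesis using that[OF \<tau>(1) x1(1) xy yn 1] by blast
qed

section \<open>Sorting a permutation while controlling the probability\<close>

lemma block_factorization_snoc:
  assumes "block_factorization n ts \<sigma>" "block_transposition n \<tau>"
  shows "block_factorization n (ts @ [\<tau>]) (\<sigma> \<circ> \<tau>)"
proof -
  interpret S: group "sym_group n" by (rule sym_group_is_group)
  have "set ts \<subseteq> carrier (sym_group n)" "\<tau> \<in> carrier (sym_group n)"
    using assms by (auto simp: block_factorization_def block_transposition_def)
  then show ?thesis
    using assms by (simp add: block_factorization_def S.list_prod_append sym_group_mult sym_group_one)
qed

text \<open>Induction on the number of leading fixed points, from the identity downwards. The bound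
  decreases with the length of the factorization, so it implies the bound for a shortest one.\<close>

lemma (in group) block_factorization_with_bound:
  assumes fin: "finite (carrier G)" and nonab: "\<not> comm_group G"
    and "j \<le> Suc n" "\<sigma> \<in> carrier (sym_group n)" "\<And>i. i < j \<Longrightarrow> \<sigma> i = i"
  shows "\<exists>ts. block_factorization n ts \<sigma> \<and>
    word_eq_prob G {1..Suc n} [1..<n + 2] (map \<sigma> [1..<n + 2]) \<le> 1 / 2 + 1 / 2 ^ (2 * length ts + 1)"
  using assms(3-)
proof (induction j arbitrary: \<sigma> rule: inc_induct)
  case base
  have "\<sigma> i = i" for i
    using base permutes_not_in[of \<sigma> "{1..n}" i] by (cases "i < Suc n") (auto simp: sym_group_carrier)
  then have \<sigma>: "\<sigma> = id" by auto
  have "block_factorization n [] \<sigma>"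
    unfolding \<sigma> by (simp add: block_factorization_def sym_group_one)
  moreover have "word_eq_prob G {1..Suc n} [1..<n + 2] (map \<sigma> [1..<n + 2]) = 1"
    unfolding \<sigma> using fin by (auto simp: word_eq_prob_def card_funcsetE)
  ultimately show ?case by (intro exI[of _ "[]"]) (simp del: upt_Suc)
next
  case (step x)
  show ?case
  proof (cases "\<sigma> x = x")
    case True
    then show ?thesis using step.prems by (intro step.IH) (auto simp: less_Suc_eq)
  next
    case False
    obtain \<tau> y A V B T where \<tau>: "block_transposition n \<tau>" and xy: "1 \<le> x" "x < y" "y \<le> n"
      and w: "map \<sigma> [1..<n + 2] = [1..<x] @ A @ y # V @ x # B @ Suc y # T"
      and w': "map (\<sigma> \<circ> \<tau>) [1..<n + 2] = [1..<x] @ x # B @ V @ A @ y # Suc y # T"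
      using block_transposition_fixing_next[OF step.prems(1,2) False] by metis
    have \<tau>_perm: "\<tau> permutes {1..n}" and \<sigma>_perm: "\<sigma> permutes {1..n}"
      using \<tau> step.prems(1) by (auto simp: block_transposition_def sym_group_carrier)
    have "\<sigma> \<circ> \<tau> \<in> carrier (sym_group n)"
      using \<tau>_perm \<sigma>_perm by (simp add: sym_group_carrier permutes_compose)
    moreover have "(\<sigma> \<circ> \<tau>) i = i" if "i < Suc x" for i
    proof (cases "i = 0")
      case True
      then show ?thesis using \<tau>_perm \<sigma>_perm by (simp add: permutes_not_in)
    next
      case False
      have "(\<sigma> \<circ> \<tau>) i = map (\<sigma> \<circ> \<tau>) [1..<n + 2] ! (i - 1)"
        using that False xy by (simp del: upt_Suc)
      also have "\<dots> = ([1..<Suc x] @ B @ V @ A @ y # Suc y # T) ! (i - 1)"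
        unfolding w' using xy by simp
      also have "\<dots> = i"
      proof -
        have "i - 1 < x" using that False by simp
        then show ?thesis using False by (simp add: nth_append del: upt_Suc)
      qed
      finally show ?thesis .
    qed
    ultimately obtain ts where ts: "block_factorization n ts (\<sigma> \<circ> \<tau>)"
      and le: "word_eq_prob G {1..Suc n} [1..<n + 2] (map (\<sigma> \<circ> \<tau>) [1..<n + 2])
        \<le> 1 / 2 + 1 / 2 ^ (2 * length ts + 1)"
      using step.IH by blast
    have "block_factorization n (ts @ [inv' \<tau>]) \<sigma>"
      using block_factorization_snoc[OF ts block_transposition_inv[OF \<tau>]]
      by (simp add: comp_assoc permutes_inv_o[OF \<tau>_perm])
    moreover have "word_eq_prob G {1..Suc n} [1..<n + 2] (map \<sigma> [1..<n + 2])
        \<le> 1 / 2 + 1 / 2 ^ (2 * length (ts @ [inv' \<tau>]) + 1)"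
    proof -
      define J where "J = {1..Suc n} - {x, y, Suc y}"
      have I: "{1..Suc n} = insert x (insert y (insert (Suc y) J))"
        using xy by (auto simp: J_def)
      have u: "[1..<n + 2] = [1..<x] @ x # [Suc x..<y] @ y # Suc y # [Suc (Suc y)..<n + 2]"
        using xy upt_split[of 1 x "n + 2"] upt_split[of "Suc x" y "n + 2"]
        by (simp add: upt_conv_Cons del: upt_Suc)
      have "\<sigma> permutes {1..Suc n}" using \<sigma>_perm by (rule permutes_subset) auto
      then have "set (map \<sigma> [1..<n + 2]) = {1..Suc n}"
        by (simp add: permutes_image atLeastLessThanSuc_atLeastAtMost del: upt_Suc)
      moreover have "distinct (map \<sigma> [1..<n + 2])"
        using permutes_inj_on[OF \<sigma>_perm] by (simp add: distinct_map del: upt_Suc)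
      ultimately have "set A \<subseteq> J" "set V \<subseteq> J" "set B \<subseteq> J" "set T \<subseteq> J"
        unfolding w by (auto simp: J_def)
      then have "word_eq_prob G {1..Suc n} [1..<n + 2] (map \<sigma> [1..<n + 2])
          \<le> 1 / 2 + (1 / 2 ^ (2 * length ts + 1)) / 4"
        using le xy unfolding w w' unfolding u I
        by (intro word_eq_prob_undo_move[OF fin nonab]) (auto simp: J_def)
      then show ?thesis by simp
    qed
    ultimately show ?thesis by blast
  qed
qed

theorem theorem4:
  fixes G :: "('a, 'b) monoid_scheme" and n k :: nat and \<sigma> :: "nat \<Rightarrow> nat"
  assumes "group G" and "finite (carrier G)" and "\<not> comm_group G"
    and "n \<ge> 2"
    and "\<sigma> \<in> carrier (sym_group n)"
    and "k = block_transposition_length n \<sigma>"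
  shows "real (card {a \<in> {1..n} \<rightarrow>\<^sub>E carrier G.
             list_prod G (map a [1..<Suc n]) = list_prod G (map (\<lambda>i. a (\<sigma> i)) [1..<Suc n])})
           / real (card (carrier G)) ^ n
         \<le> 1 / 2 + 1 / 2 ^ (2 * k + 1)"
proof -
  interpret group G by fact
  have perm: "\<sigma> permutes {1..n}" using assms(5) by (simp add: sym_group_carrier)
  have "\<sigma> i = i" if "i < 1" for i using that permutes_not_in[OF perm, of i] by simp
  then obtain ts where ts: "block_factorization n ts \<sigma>"
    and le: "word_eq_prob G {1..Suc n} [1..<n + 2] (map \<sigma> [1..<n + 2]) \<le> 1 / 2 + 1 / 2 ^ (2 * length ts + 1)"
    using block_factorization_with_bound[OF assms(2,3) _ assms(5), of 1] by auto
  have "k \<le> length ts"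
    unfolding assms(6) block_transposition_length_def using ts by (intro Least_le) blast
  then have "1 / 2 ^ (2 * length ts + 1) \<le> (1 / 2 ^ (2 * k + 1) :: real)"
    by (intro divide_left_mono power_increasing) auto
  moreover have "word_eq_prob G {1..Suc n} [1..<n + 2] (map \<sigma> [1..<n + 2]) =
      word_eq_prob G {1..n} [1..<Suc n] (map \<sigma> [1..<Suc n])"
  proof -
    have word: "[1..<n + 2] = [1..<Suc n] @ [Suc n]"
        "map \<sigma> ([1..<Suc n] @ [Suc n]) = map \<sigma> [1..<Suc n] @ [Suc n]"
      using permutes_not_in[OF perm, of "Suc n"] by auto
    have letters: "{1..Suc n} = insert (Suc n) {1..n}" by auto
    have "set (map \<sigma> [1..<Suc n]) \<subseteq> {1..n}"
      using permutes_image[OF perm] by (simp add: atLeastLessThanSuc_atLeastAtMost del: upt_Suc)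
    then show ?thesis
      unfolding word letters by (rule word_eq_prob_append_fresh[OF assms(2), rotated 3])
        (simp_all add: atLeastLessThanSuc_atLeastAtMost del: upt_Suc)
  qed
  ultimately have "word_eq_prob G {1..n} [1..<Suc n] (map \<sigma> [1..<Suc n]) \<le> 1 / 2 + 1 / 2 ^ (2 * k + 1)"
    using le by linarith
  then show ?thesis by (simp add: word_eq_prob_def o_def del: upt_Suc)
qed

end
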